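(* Let $\mu$ be a positive measure on the ball $\mathbb{B}_n$. Then $\mu$ is $H_n^2$-Carleson if and only if there is $C<\infty$ such that $$\int_{\mathbb{B}_n}\int_{\mathbb{B}_n}\left(\operatorname{Re}\frac{1}{1-\overline z\cdot z'}\right)f(z')\,d\mu(z')\,g(z)\,d\mu(z)\le C\|f\|_{L^2(\mu)}\|g\|_{L^2(\mu)}$$ for all $f,g\ge0$. Moreover, provided the $H_n^2$ norm is used in the definition of Carleson measures, the constants implicit in this statement are independent of the dimension $n$.
   Context: $H_n^2$ is the Drury–Arveson space: the Hilbert space of holomorphic functions on the unit ball $\mathbb{B}_n\subset\mathbb{C}^n$ with reproducing kernel $\frac{1}{1-\overline w\cdot z}$. $\mu$ is $H_n^2$-Carleson if there is a constant $C_\mu$ with $\int_{\mathbb{B}_n}|h|^2d\mu\le C_\mu\|h\|_{H_n^2}^2$ for all $h\in H_n^2$.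
   Formalization: The positive measure μ is assumed to be a σ-finite Borel measure (this includes all those finite on compact sets); for arbitrary positive measures the claim fails, e.g. for an infinite point mass at the origin, where the bilinear bound holds with C=0 but μ is not Carleson. *)

theory Defs
  imports "HOL-Analysis.Analysis"
begin

text \<open>
  The dimension has to be quantified inside the statement, so \<open>\<complex>\<^sup>n\<close> is the set of sequences
  vanishing from index \<open>n\<close> on.  On this set the product topology of \<^typ>\<open>nat \<Rightarrow> complex\<close>, and
  its Borel sets, induce the usual topology and Borel sets of \<open>\<complex>\<^sup>n\<close>.
\<close>

definition unit_ball :: "nat \<Rightarrow> (nat \<Rightarrow> complex) set" where
  "unit_ball n = {z. (\<forall>i\<ge>n. z i = 0) \<and> (\<Sum>i<n. (cmod (z i))\<^sup>2) < 1}"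

definition hdot :: "nat \<Rightarrow> (nat \<Rightarrow> complex) \<Rightarrow> (nat \<Rightarrow> complex) \<Rightarrow> complex" where
  "hdot n w z = (\<Sum>i<n. cnj (w i) * z i)"

text \<open>By Osgood's lemma this agrees with the other definitions of holomorphy on the ball.\<close>

definition holomorphic_on_unit_ball :: "nat \<Rightarrow> ((nat \<Rightarrow> complex) \<Rightarrow> complex) \<Rightarrow> bool" where
  "holomorphic_on_unit_ball n h \<longleftrightarrow>
     continuous_on (unit_ball n) h \<and>
     (\<forall>z\<in>unit_ball n. \<forall>i<n.
        (\<lambda>\<zeta>. h (z(i := \<zeta>))) holomorphic_on {\<zeta>. z(i := \<zeta>) \<in> unit_ball n})"

text \<open>
  Complex Hilbert spaces of functions on \<open>X\<close>, with inner product linear in the first argument.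
  A function on \<open>X\<close> is represented by its extension by zero, so that equality of functions
  on \<open>X\<close> is equality in HOL.
\<close>

locale hilbert_function_space =
  fixes X :: "'a set"
    and H :: "('a \<Rightarrow> complex) set"
    and ip :: "('a \<Rightarrow> complex) \<Rightarrow> ('a \<Rightarrow> complex) \<Rightarrow> complex"
  assumes zero_outside: "f \<in> H \<Longrightarrow> x \<notin> X \<Longrightarrow> f x = 0"
    and zero_mem: "(\<lambda>x. 0) \<in> H"
    and add_mem: "f \<in> H \<Longrightarrow> g \<in> H \<Longrightarrow> (\<lambda>x. f x + g x) \<in> H"
    and scale_mem: "f \<in> H \<Longrightarrow> (\<lambda>x. c * f x) \<in> H"
    and ip_add: "f \<in> H \<Longrightarrow> g \<in> H \<Longrightarrow> h \<in> H \<Longrightarrow> ip (\<lambda>x. f x + g x) h = ip f h + ip g h"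
    and ip_scale: "f \<in> H \<Longrightarrow> h \<in> H \<Longrightarrow> ip (\<lambda>x. c * f x) h = c * ip f h"
    and ip_cnj: "f \<in> H \<Longrightarrow> g \<in> H \<Longrightarrow> ip g f = cnj (ip f g)"
    and ip_nonneg: "f \<in> H \<Longrightarrow> 0 \<le> Re (ip f f)"
    and ip_definite: "f \<in> H \<Longrightarrow> ip f f = 0 \<Longrightarrow> f = (\<lambda>x. 0)"
    and complete: "Metric_space.mcomplete H
      (\<lambda>f g. sqrt (Re (ip (\<lambda>x. f x - g x) (\<lambda>x. f x - g x))))"

definition has_reproducing_kernel ::
  "'a set \<Rightarrow> ('a \<Rightarrow> complex) set \<Rightarrow> (('a \<Rightarrow> complex) \<Rightarrow> ('a \<Rightarrow> complex) \<Rightarrow> complex)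
    \<Rightarrow> ('a \<Rightarrow> 'a \<Rightarrow> complex) \<Rightarrow> bool" where
  "has_reproducing_kernel X H ip K \<longleftrightarrow>
     (\<forall>w\<in>X. (\<lambda>z. if z \<in> X then K z w else 0) \<in> H \<and>
        (\<forall>h\<in>H. h w = ip h (\<lambda>z. if z \<in> X then K z w else 0)))"

text \<open>
  The conditions below determine \<open>H\<close>, and \<open>ip\<close> on \<open>H\<close>, uniquely: a Hilbert space of functions
  is determined by its reproducing kernel.
\<close>

definition drury_arveson ::
  "nat \<Rightarrow> ((nat \<Rightarrow> complex) \<Rightarrow> complex) set
    \<Rightarrow> (((nat \<Rightarrow> complex) \<Rightarrow> complex) \<Rightarrow> ((nat \<Rightarrow> complex) \<Rightarrow> complex) \<Rightarrow> complex) \<Rightarrow> bool" where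
  "drury_arveson n H ip \<longleftrightarrow>
     hilbert_function_space (unit_ball n) H ip \<and>
     (\<forall>h\<in>H. holomorphic_on_unit_ball n h) \<and>
     has_reproducing_kernel (unit_ball n) H ip (\<lambda>z w. 1 / (1 - hdot n w z))"

text \<open>
  Sigma-finiteness covers all Borel measures that are finite on compact subsets of the ball.
  Without some such condition the equivalence fails: if \<open>\<mu>\<close> is infinite on the origin and zero
  elsewhere, then \<open>L\<^sup>2(\<mu>)\<close> is trivial but \<open>\<mu>\<close> is not Carleson.
\<close>

definition measure_on_unit_ball :: "nat \<Rightarrow> (nat \<Rightarrow> complex) measure \<Rightarrow> bool" where
  "measure_on_unit_ball n \<mu> \<longleftrightarrow>
     sets \<mu> = sets (restrict_space borel (unit_ball n)) \<and> sigma_finite_measure \<mu>"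

definition carleson_bound ::
  "((nat \<Rightarrow> complex) \<Rightarrow> complex) set
    \<Rightarrow> (((nat \<Rightarrow> complex) \<Rightarrow> complex) \<Rightarrow> ((nat \<Rightarrow> complex) \<Rightarrow> complex) \<Rightarrow> complex)
    \<Rightarrow> (nat \<Rightarrow> complex) measure \<Rightarrow> real \<Rightarrow> bool" where
  "carleson_bound H ip \<mu> C \<longleftrightarrow>
     (\<forall>h\<in>H. (\<integral>\<^sup>+ z. ennreal ((cmod (h z))\<^sup>2) \<partial>\<mu>) \<le> ennreal (C * Re (ip h h)))"

definition carleson ::
  "((nat \<Rightarrow> complex) \<Rightarrow> complex) set
    \<Rightarrow> (((nat \<Rightarrow> complex) \<Rightarrow> complex) \<Rightarrow> ((nat \<Rightarrow> complex) \<Rightarrow> complex) \<Rightarrow> complex)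
    \<Rightarrow> (nat \<Rightarrow> complex) measure \<Rightarrow> bool" where
  "carleson H ip \<mu> \<longleftrightarrow> (\<exists>C\<ge>0. carleson_bound H ip \<mu> C)"

definition nonneg_L2 :: "'a measure \<Rightarrow> ('a \<Rightarrow> real) \<Rightarrow> bool" where
  "nonneg_L2 \<mu> f \<longleftrightarrow>
     f \<in> borel_measurable \<mu> \<and> integrable \<mu> (\<lambda>z. (f z)\<^sup>2) \<and> (\<forall>z\<in>space \<mu>. 0 \<le> f z)"

definition L2_norm :: "'a measure \<Rightarrow> ('a \<Rightarrow> real) \<Rightarrow> real" where
  "L2_norm \<mu> f = sqrt (\<integral>z. (f z)\<^sup>2 \<partial>\<mu>)"

text \<open>
  The real part of the kernel is positive on the ball, so all integrands are nonnegative and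
  the coercion to \<^typ>\<open>ennreal\<close> truncates nothing.
\<close>

definition bilinear_bound :: "nat \<Rightarrow> (nat \<Rightarrow> complex) measure \<Rightarrow> real \<Rightarrow> bool" where
  "bilinear_bound n \<mu> C \<longleftrightarrow>
     (\<forall>f g. nonneg_L2 \<mu> f \<longrightarrow> nonneg_L2 \<mu> g \<longrightarrow>
        (\<integral>\<^sup>+ z. (\<integral>\<^sup>+ z'. ennreal (Re (1 / (1 - hdot n z z')) * f z') \<partial>\<mu>) * ennreal (g z) \<partial>\<mu>)
          \<le> ennreal (C * L2_norm \<mu> f * L2_norm \<mu> g))"

end

theory Submission
  imports Defs
begin

text \<open>
  Write \<open>K(z,w) = 1 / (1 - \<langle>z,w\<rangle>)\<close> for the kernel, \<open>k\<^sub>w = K(\<cdot>,w)\<close>, \<open>R = Re K\<close>, and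
  \<open>U f(z) = \<integral> R(z,w) f(w) d\<mu>(w)\<close> for real \<open>f\<close>.  If \<open>J\<close> is the inclusion of the Drury--Arveson
  space into \<open>L\<^sup>2(\<mu>)\<close>, then \<open>J\<^sup>* f = \<integral> k\<^sub>w f(w) d\<mu>(w)\<close>.  Hence \<open>U f = Re (J J\<^sup>* f)\<close>, and since
  the imaginary part of \<open>K\<close> is antisymmetric, \<open>\<parallel>J\<^sup>* f\<parallel>\<^sup>2 = \<integral> (U f) f d\<mu>\<close>.  The theorem says that \<open>J\<close>
  is bounded if and only if the form \<open>\<integral> (U f) g d\<mu>\<close> is bounded on nonnegative functions.

  If \<open>\<parallel>J\<parallel>\<^sup>2 \<le> C\<close>, then \<open>\<integral> (U f)\<^sup>2 d\<mu> \<le> C \<parallel>J\<^sup>* f\<parallel>\<^sup>2 = C \<integral> (U f) f d\<mu>\<close>.  By Cauchy--Schwarz \<open>U\<close> has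
  norm at most \<open>C\<close> on \<open>L\<^sup>2(\<mu>)\<close>, and the bilinear bound follows with the same constant.

  Conversely, let the form be bounded by \<open>C\<close> on nonnegative functions and let \<open>f = a - b\<close> with
  \<open>a, b\<close> the positive and negative parts.  As \<open>R \<ge> 0\<close> on the ball, the cross terms of
  \<open>\<integral> (U f) f d\<mu>\<close> are nonpositive, so \<open>\<parallel>J\<^sup>* f\<parallel>\<^sup>2 \<le> C (\<parallel>a\<parallel>\<^sup>2 + \<parallel>b\<parallel>\<^sup>2) = C \<parallel>f\<parallel>\<^sup>2\<close>.
  Testing an element \<open>h\<close> of the space against \<open>J\<^sup>* (Re h)\<close> gives
  \<open>\<integral> (Re h)\<^sup>2 d\<mu> \<le> C \<parallel>h\<parallel>\<^sup>2\<close>.  The same estimate for \<open>-\<i> h\<close> controls \<open>Im h\<close>, and the sum is the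
  Carleson bound with \<open>2 C\<close>.  No step produces a constant that depends on the dimension.

  To make sense of \<open>J\<^sup>* f\<close> without vector-valued integrals, every \<open>f\<close> is first cut off to a set of
  finite measure whose points stay away from the sphere; there \<open>K\<close> is bounded.
  Replacing \<open>k\<^sub>w\<close> by \<open>k\<^bsub>s w\<^esub>\<close>, where \<open>s\<close> rounds all coordinates to a grid, then turns the integral into
  a finite combination of kernels (\<open>test_function\<close>).  The estimates for these combinations pass to
  the limit of fine grids by dominated convergence and Fatou's lemma (\<open>tendsto_potential\<close>,
  \<open>tendsto_energy\<close>), and the cut-off is removed by monotone convergence (\<open>exhaustion\<close>).
  The two implications are \<open>carleson_imp_bilinear\<close> and \<open>bilinear_imp_carleson\<close>.
\<close>

section \<open>The real part of the kernel\<close>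

definition sq_norm :: "nat \<Rightarrow> (nat \<Rightarrow> complex) \<Rightarrow> real" where
  "sq_norm n z = (\<Sum>i<n. (cmod (z i))\<^sup>2)"

definition re_kernel :: "nat \<Rightarrow> (nat \<Rightarrow> complex) \<Rightarrow> (nat \<Rightarrow> complex) \<Rightarrow> real" where
  "re_kernel n z w = Re (1 / (1 - hdot n z w))"

lemma unit_ball_iff: "z \<in> unit_ball n \<longleftrightarrow> (\<forall>i\<ge>n. z i = 0) \<and> sq_norm n z < 1"
  by (simp add: unit_ball_def sq_norm_def)

lemma hdot_commute: "hdot n w z = cnj (hdot n z w)"
  by (simp add: hdot_def mult.commute)

lemma re_kernel_commute: "re_kernel n z w = re_kernel n w z"
proof -
  have "1 / (1 - hdot n z w) = cnj (1 / (1 - hdot n w z))"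
    by (subst hdot_commute) simp
  then show ?thesis unfolding re_kernel_def by (metis complex_cnj(1) complex.sel(1) cnj.simps(1))
qed

text \<open>
  The arithmetic mean takes the place of the product of the norms: it avoids square roots and still
  keeps the inner product inside the unit disc.
\<close>

lemma norm_hdot_le: "cmod (hdot n z w) \<le> (sq_norm n z + sq_norm n w) / 2"
proof -
  have "cmod (hdot n z w) \<le> (\<Sum>i<n. cmod (z i) * cmod (w i))"
    unfolding hdot_def by (rule order_trans[OF norm_sum]) (simp add: norm_mult)
  also have "\<dots> \<le> (\<Sum>i<n. ((cmod (z i))\<^sup>2 + (cmod (w i))\<^sup>2) / 2)"
  proof (rule sum_mono)
    fix i
    show "cmod (z i) * cmod (w i) \<le> ((cmod (z i))\<^sup>2 + (cmod (w i))\<^sup>2) / 2"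
      using sum_squares_bound[of "cmod (z i)" "cmod (w i)"] by simp
  qed
  also have "\<dots> = (sq_norm n z + sq_norm n w) / 2"
    by (simp add: sq_norm_def sum.distrib flip: sum_divide_distrib)
  finally show ?thesis .
qed

lemma one_minus_hdot_bound:
  assumes "sq_norm n z < 1" "sq_norm n w \<le> \<rho>"
  shows "(1 - \<rho>) / 2 \<le> cmod (1 - hdot n z w)"
  using norm_triangle_ineq2[of 1 "hdot n z w"] norm_hdot_le[of n z w] assms
  by (simp add: field_simps)

lemma hdot_neq_1:
  assumes "sq_norm n z < 1" "sq_norm n w < 1"
  shows "hdot n z w \<noteq> 1"
  using norm_hdot_le[of n z w] assms by auto

text \<open>
  The map \<open>\<zeta> \<mapsto> 1 / (1 - \<zeta>)\<close> sends the unit disc into the right half-plane.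
\<close>

lemma re_kernel_nonneg:
  assumes "sq_norm n z < 1" "sq_norm n w < 1"
  shows "0 \<le> re_kernel n z w"
proof -
  have "Re (hdot n z w) \<le> 1"
    using norm_hdot_le[of n z w] complex_Re_le_cmod[of "hdot n z w"] assms
    by (simp add: field_simps)
  then show ?thesis
    by (simp add: re_kernel_def Re_complex_div_ge_0)
qed

lemma re_kernel_bound:
  assumes "sq_norm n z < 1" "sq_norm n w \<le> \<rho>" "\<rho> < 1"
  shows "\<bar>re_kernel n z w\<bar> \<le> 2 / (1 - \<rho>)"
proof -
  have "\<bar>re_kernel n z w\<bar> \<le> 1 / cmod (1 - hdot n z w)"
    unfolding re_kernel_def by (rule order_trans[OF abs_Re_le_cmod]) (simp add: norm_divide)
  also have "\<dots> \<le> 1 / ((1 - \<rho>) / 2)"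
    using one_minus_hdot_bound[OF assms(1,2)] assms(3) by (intro divide_left_mono mult_pos_pos) auto
  finally show ?thesis by simp
qed

lemma tendsto_re_kernel:
  assumes "\<And>i. (\<lambda>N. z N i) \<longlonglongrightarrow> z' i" "\<And>i. (\<lambda>N. w N i) \<longlonglongrightarrow> w' i"
    and "sq_norm n z' < 1" "sq_norm n w' < 1"
  shows "(\<lambda>N. re_kernel n (z N) (w N)) \<longlonglongrightarrow> re_kernel n z' w'"
proof -
  have "(\<lambda>N. hdot n (z N) (w N)) \<longlonglongrightarrow> hdot n z' w'"
    unfolding hdot_def by (intro tendsto_intros assms)
  with hdot_neq_1[OF assms(3,4)] show ?thesis
    unfolding re_kernel_def by (intro tendsto_intros) auto
qed

section \<open>Rounding the coordinates towards zero\<close>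

text \<open>
  Rounding towards zero, and not to the nearest grid point, increases no modulus and so keeps points
  of the ball in the ball.
\<close>

definition round0 :: "nat \<Rightarrow> real \<Rightarrow> real" where
  "round0 N x = sgn x * of_int \<lfloor>real (Suc N) * \<bar>x\<bar>\<rfloor> / real (Suc N)"

definition grid :: "nat \<Rightarrow> (nat \<Rightarrow> complex) \<Rightarrow> nat \<Rightarrow> complex" where
  "grid N z = (\<lambda>i. Complex (round0 N (Re (z i))) (round0 N (Im (z i))))"

lemma round0_le: "\<bar>round0 N x\<bar> \<le> \<bar>x\<bar>"
proof -
  have "of_int \<lfloor>real (Suc N) * \<bar>x\<bar>\<rfloor> \<le> real (Suc N) * \<bar>x\<bar>" "0 \<le> \<lfloor>real (Suc N) * \<bar>x\<bar>\<rfloor>"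
    by (auto simp del: of_nat_Suc)
  then show ?thesis
    by (auto simp: round0_def abs_mult sgn_if field_simps simp del: of_nat_Suc)
qed

lemma round0_error: "\<bar>round0 N x - x\<bar> \<le> 1 / real (Suc N)"
proof -
  define k where "k = \<lfloor>real (Suc N) * \<bar>x\<bar>\<rfloor>"
  have k: "of_int k \<le> real (Suc N) * \<bar>x\<bar>" "real (Suc N) * \<bar>x\<bar> < of_int k + 1"
    unfolding k_def by linarith+
  have "round0 N x - x = sgn x * (of_int k - real (Suc N) * \<bar>x\<bar>) / real (Suc N)"
    unfolding round0_def k_def[symmetric]
    by (auto simp: sgn_if field_simps simp del: of_nat_Suc)
  moreover have "\<bar>sgn x * (of_int k - real (Suc N) * \<bar>x\<bar>)\<bar> \<le> 1"
    using k by (auto simp: abs_mult sgn_if simp del: of_nat_Suc)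
  ultimately show ?thesis
    by (simp add: divide_right_mono del: of_nat_Suc)
qed

lemma tendsto_round0: "(\<lambda>N. round0 N x) \<longlonglongrightarrow> x"
proof (rule LIM_zero_cancel, rule Lim_null_comparison)
  show "eventually (\<lambda>N. norm (round0 N x - x) \<le> 1 / real (Suc N)) sequentially"
    using round0_error by simp
  show "(\<lambda>N. 1 / real (Suc N)) \<longlonglongrightarrow> 0"
    using LIMSEQ_inverse_real_of_nat by (simp add: inverse_eq_divide)
qed

lemma finite_range_round0: "finite (round0 N ` {-1..1})"
proof (rule finite_subset)
  show "round0 N ` {-1..1} \<subseteq>
    (\<lambda>(a, k). a * of_int k / real (Suc N)) ` ({-1, 0, 1} \<times> {0..int (Suc N)})"
  proof clarify
    fix x :: real assume x: "x \<in> {-1..1}"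
    have "real (Suc N) * \<bar>x\<bar> \<le> real (Suc N)" using x by (auto simp: abs_le_iff mult_le_cancel_left2 simp del: of_nat_Suc)
    then have "\<lfloor>real (Suc N) * \<bar>x\<bar>\<rfloor> \<le> int (Suc N)" by linarith
    then have "(sgn x, \<lfloor>real (Suc N) * \<bar>x\<bar>\<rfloor>) \<in> {-1, 0, 1} \<times> {0..int (Suc N)}"
      by (auto simp: sgn_if simp del: of_nat_Suc)
    then show "round0 N x \<in> (\<lambda>(a, k). a * of_int k / real (Suc N)) ` ({-1, 0, 1} \<times> {0..int (Suc N)})"
      unfolding round0_def by force
  qed
qed auto

lemma cmod_grid_le: "cmod (grid N z i) \<le> cmod (z i)"
  unfolding grid_def cmod_def using round0_le[of N]
  by (auto intro!: add_mono simp: abs_le_square_iff)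

lemma sq_norm_grid_le: "sq_norm n (grid N z) \<le> sq_norm n z"
  unfolding sq_norm_def by (intro sum_mono power_mono cmod_grid_le) auto

lemma grid_in_unit_ball: "z \<in> unit_ball n \<Longrightarrow> grid N z \<in> unit_ball n"
  using sq_norm_grid_le[of n N z] by (auto simp: unit_ball_iff grid_def round0_def complex_eq_iff)

lemma tendsto_grid: "(\<lambda>N. grid N z i) \<longlonglongrightarrow> z i"
  unfolding grid_def using tendsto_Complex[OF tendsto_round0 tendsto_round0, of "Re (z i)" "Im (z i)"]
  by simp

text \<open>
  This turns integrals over the ball of functions of the rounded point into finite sums.
\<close>

lemma finite_range_grid: "finite (grid N ` unit_ball n)"
proof (rule finite_subset)
  let ?A = "round0 N ` {-1..1}"
  let ?B = "(\<lambda>(x, y). Complex x y) ` (?A \<times> ?A)"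
  show "finite {z. \<forall>i. (i \<in> {..<n} \<longrightarrow> z i \<in> ?B) \<and> (i \<notin> {..<n} \<longrightarrow> z i = 0)}"
    by (intro finite_set_of_finite_funs finite_imageI finite_cartesian_product finite_range_round0) auto
  show "grid N ` unit_ball n \<subseteq> {z. \<forall>i. (i \<in> {..<n} \<longrightarrow> z i \<in> ?B) \<and> (i \<notin> {..<n} \<longrightarrow> z i = 0)}"
  proof clarify
    fix z i assume z: "z \<in> unit_ball n"
    have "grid N z i \<in> ?B" if i: "i < n"
    proof -
      have "(cmod (z i))\<^sup>2 \<le> sq_norm n z"
        unfolding sq_norm_def using i by (intro member_le_sum) auto
      then have "(cmod (z i))\<^sup>2 \<le> 1" using z by (auto simp: unit_ball_iff)
      then have "cmod (z i) \<le> 1" by (simp add: power_le_one_iff)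
      then have "Re (z i) \<in> {-1..1}" "Im (z i) \<in> {-1..1}"
        using abs_Re_le_cmod[of "z i"] abs_Im_le_cmod[of "z i"] by auto
      then show ?thesis by (auto simp: grid_def)
    qed
    then show "(i \<in> {..<n} \<longrightarrow> grid N z i \<in> ?B) \<and> (i \<notin> {..<n} \<longrightarrow> grid N z i = 0)"
      using z grid_in_unit_ball[OF z, of N] by (auto simp: unit_ball_iff)
  qed
qed

lemma borel_measurable_round0 [measurable]: "round0 N \<in> borel_measurable borel"
  unfolding round0_def[abs_def] by measurable

lemma borel_measurable_coordinate [measurable]: "(\<lambda>z::nat \<Rightarrow> complex. z i) \<in> borel_measurable borel"
  by (rule measurable_product_coordinates)

lemma borel_measurable_grid [measurable]: "grid N \<in> borel_measurable borel"
proof (rule measurable_coordinatewise_then_product)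
  fix i
  have "(\<lambda>z. grid N z i) = (\<lambda>z. of_real (round0 N (Re (z i))) + \<i> * of_real (round0 N (Im (z i))))"
    by (auto simp: grid_def complex_eq_iff)
  then show "(\<lambda>z. grid N z i) \<in> borel_measurable borel"
    by simp
qed

lemma borel_measurable_sq_norm [measurable]: "sq_norm n \<in> borel_measurable borel"
  unfolding sq_norm_def[abs_def] by measurable

lemma borel_measurable_re_kernel [measurable]:
  assumes [measurable]: "u \<in> borel_measurable M" "v \<in> borel_measurable M"
  shows "(\<lambda>x. re_kernel n (u x) (v x)) \<in> borel_measurable M"
proof -
  have u: "(\<lambda>x. u x i) \<in> borel_measurable M" and v: "(\<lambda>x. v x i) \<in> borel_measurable M" for i
    using measurable_compose[OF assms(1) borel_measurable_coordinate]
      measurable_compose[OF assms(2) borel_measurable_coordinate] by auto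
  have cnj: "cnj \<in> borel_measurable borel"
    by (intro borel_measurable_continuous_onI continuous_intros)
  have "(\<lambda>x. hdot n (u x) (v x)) \<in> borel_measurable M"
    unfolding hdot_def
    by (intro borel_measurable_sum borel_measurable_times v measurable_compose[OF u cnj])
  then show ?thesis unfolding re_kernel_def by simp
qed

section \<open>Finite kernel combinations in a Hilbert function space\<close>

context hilbert_function_space
begin

lemma ip_add_right:
  assumes "f \<in> H" "g \<in> H" "h \<in> H"
  shows "ip h (\<lambda>x. f x + g x) = ip h f + ip h g"
proof -
  have "ip h (\<lambda>x. f x + g x) = cnj (ip (\<lambda>x. f x + g x) h)"
    using assms by (intro ip_cnj add_mem)
  then show ?thesis
    using assms by (simp add: ip_add ip_cnj[of h f] ip_cnj[of h g])
qed

lemma ip_scale_right: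
  assumes "f \<in> H" "h \<in> H"
  shows "ip h (\<lambda>x. c * f x) = cnj c * ip h f"
proof -
  have "ip h (\<lambda>x. c * f x) = cnj (ip (\<lambda>x. c * f x) h)"
    using assms by (intro ip_cnj scale_mem)
  then show ?thesis
    using assms by (simp add: ip_scale ip_cnj[of h f])
qed

lemma Re_ip_commute: "f \<in> H \<Longrightarrow> g \<in> H \<Longrightarrow> Re (ip g f) = Re (ip f g)"
  using ip_cnj[of f g] by simp

lemma Re_ip_Cauchy_Schwarz:
  assumes "f \<in> H" "g \<in> H"
  shows "(Re (ip f g))\<^sup>2 \<le> Re (ip f f) * Re (ip g g)"
proof -
  have sq: "0 \<le> a + 2 * t * b + t\<^sup>2 * c"
    if "a = Re (ip f f)" "b = Re (ip f g)" "c = Re (ip g g)" for a b c t :: real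
  proof -
    define u where "u = (\<lambda>x. complex_of_real t * g x)"
    have u: "u \<in> H" unfolding u_def using assms by (intro scale_mem)
    have "0 \<le> Re (ip (\<lambda>x. f x + u x) (\<lambda>x. f x + u x))"
      using assms u by (intro ip_nonneg add_mem)
    also have "\<dots> = Re (ip f f) + Re (ip f u) + Re (ip u f) + Re (ip u u)"
      using assms u by (simp add: ip_add ip_add_right add_mem)
    also have "\<dots> = a + 2 * t * b + t\<^sup>2 * c"
      using assms u that
      by (simp add: Re_ip_commute[of f u])
        (simp add: u_def ip_scale_right ip_scale scale_mem power2_eq_square)
    finally show ?thesis .
  qed
  have nonneg: "0 \<le> Re (ip f f)" "0 \<le> Re (ip g g)" using assms by (auto intro: ip_nonneg)
  show ?thesis
  proof (cases "Re (ip g g) = 0")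
    case True
    have "Re (ip f g) = 0"
    proof (rule ccontr)
      assume "Re (ip f g) \<noteq> 0"
      then show False
        \<comment> \<open>Without a quadratic term, this value of \<open>t\<close> would make the square of the norm negative.\<close>
        using sq[OF refl refl refl, of "- (Re (ip f f) + 1) / (2 * Re (ip f g))"] True by (simp add: field_simps)
    qed
    with True show ?thesis by simp
  next
    case False
    then have "0 < Re (ip g g)" using nonneg by simp
    \<comment> \<open>The minimum of the quadratic polynomial in \<open>t\<close>.\<close>
    with sq[OF refl refl refl, of "- Re (ip f g) / Re (ip g g)"] show ?thesis
      by (simp add: field_simps power2_eq_square)
  qed
qed

lemma kernel_combination:
  assumes K: "has_reproducing_kernel X H ip K" and "finite P" "P \<subseteq> X"
  shows "\<exists>F\<in>H. (\<forall>h\<in>H. ip h F = (\<Sum>p\<in>P. cnj (c p) * h p)) \<and> (\<forall>z\<in>X. F z = (\<Sum>p\<in>P. c p * K z p))"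
  using assms(2,3)
proof (induction P)
  case empty
  have "ip h (\<lambda>x. 0) = 0" if "h \<in> H" for h
    using ip_scale_right[OF zero_mem that, of 0] by simp
  then show ?case using zero_mem by (intro bexI[of _ "\<lambda>x. 0"]) auto
next
  case (insert p P)
  then obtain F where F: "F \<in> H" "\<And>h. h \<in> H \<Longrightarrow> ip h F = (\<Sum>p\<in>P. cnj (c p) * h p)"
    "\<And>z. z \<in> X \<Longrightarrow> F z = (\<Sum>p\<in>P. c p * K z p)" by auto
  define k where "k = (\<lambda>z. if z \<in> X then K z p else 0)"
  have k: "k \<in> H" "\<And>h. h \<in> H \<Longrightarrow> ip h k = h p"
    using K insert.prems by (auto simp: has_reproducing_kernel_def k_def)
  have ck: "(\<lambda>z. c p * k z) \<in> H" using k by (intro scale_mem)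
  have "ip h (\<lambda>z. c p * k z + F z) = (\<Sum>p\<in>insert p P. cnj (c p) * h p)" if "h \<in> H" for h
    using insert.hyps that by (simp add: ip_add_right[OF ck F(1) that] ip_scale_right[OF k(1) that] k(2) F(2))
  moreover have "c p * k z + F z = (\<Sum>p\<in>insert p P. c p * K z p)" if "z \<in> X" for z
    using insert.hyps that by (simp add: k_def F(3))
  moreover have "(\<lambda>z. c p * k z + F z) \<in> H" using ck F(1) by (rule add_mem)
  ultimately show ?case by blast
qed

end

lemma ennreal_power2_le_imp_le:
  assumes "x\<^sup>2 \<le> ennreal (c\<^sup>2)" "0 \<le> c"
  shows "x \<le> ennreal c"
proof (cases x)
  case (real r)
  with assms have "r\<^sup>2 \<le> c\<^sup>2" by (simp add: ennreal_power)
  then have "r \<le> c" using assms(2) by (rule power2_le_imp_le)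
  with real show ?thesis by (simp add: ennreal_leI)
next
  case top
  with assms show ?thesis by (simp add: top_unique)
qed

section \<open>Potentials of functions supported well inside the ball\<close>

locale ball_measure = sigma_finite_measure M
  for M :: "(nat \<Rightarrow> complex) measure" +
  fixes n :: nat
  assumes sets_eq: "sets M = sets (restrict_space borel (unit_ball n))"
begin

lemma space_eq: "space M = unit_ball n"
  using sets_eq_imp_space_eq[OF sets_eq] by (simp add: space_restrict_space)

lemma measurable_on_ball: "g \<in> borel_measurable borel \<Longrightarrow> g \<in> borel_measurable M"
  by (simp add: measurable_cong_sets[OF sets_eq refl] measurable_restrict_space1)

text \<open>
  Both the identity and the grid maps satisfy this.  The rounded and the unrounded potentials thus
  obey the same bounds, which is what dominated convergence needs.
\<close>

definition shrinking :: "((nat \<Rightarrow> complex) \<Rightarrow> nat \<Rightarrow> complex) \<Rightarrow> bool" where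
  "shrinking s \<longleftrightarrow> s \<in> borel_measurable M \<and>
     (\<forall>w\<in>unit_ball n. s w \<in> unit_ball n \<and> sq_norm n (s w) \<le> sq_norm n w)"

lemma shrinking_grid: "shrinking (grid N)"
  by (auto simp: shrinking_def measurable_on_ball grid_in_unit_ball sq_norm_grid_le)

lemma shrinking_id: "shrinking (\<lambda>w. w)"
  by (auto simp: shrinking_def measurable_on_ball)

text \<open>
  Support in a smaller concentric ball makes the kernel bounded on the support, uniformly in the
  other variable, so that integrability of \<open>f\<close> suffices for its potential and energy to exist.
\<close>

definition inner_L1 :: "((nat \<Rightarrow> complex) \<Rightarrow> real) \<Rightarrow> bool" where
  "inner_L1 f \<longleftrightarrow> integrable M f \<and>
     (\<exists>\<rho><1. \<forall>w\<in>unit_ball n. f w \<noteq> 0 \<longrightarrow> sq_norm n w \<le> \<rho>)"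

text \<open>
  This is \<open>Re (J J\<^sup>* f)\<close> when \<open>s\<close> is the identity, and the same with \<open>k\<^sub>w\<close> replaced by \<open>k\<^bsub>s w\<^esub>\<close> in
  general.
\<close>

definition potential ::
  "((nat \<Rightarrow> complex) \<Rightarrow> nat \<Rightarrow> complex) \<Rightarrow> ((nat \<Rightarrow> complex) \<Rightarrow> real) \<Rightarrow> (nat \<Rightarrow> complex) \<Rightarrow> real" where
  "potential s f z = (\<integral>w. re_kernel n z (s w) * f w \<partial>M)"

lemma inner_L1_kernel_bound:
  assumes "inner_L1 f"
  obtains B where "0 \<le> B" "\<And>s z w. shrinking s \<Longrightarrow> z \<in> unit_ball n \<Longrightarrow> w \<in> unit_ball n \<Longrightarrow>
    \<bar>re_kernel n z (s w) * f w\<bar> \<le> B * \<bar>f w\<bar>"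
proof -
  from assms obtain \<rho> where \<rho>: "\<rho> < 1" "\<And>w. w \<in> unit_ball n \<Longrightarrow> f w \<noteq> 0 \<Longrightarrow> sq_norm n w \<le> \<rho>"
    by (auto simp: inner_L1_def)
  show thesis
  proof (rule that[of "2 / (1 - \<rho>)"])
    fix s z w
    assume s: "shrinking s" and z: "z \<in> unit_ball n" and w: "w \<in> unit_ball n"
    show "\<bar>re_kernel n z (s w) * f w\<bar> \<le> 2 / (1 - \<rho>) * \<bar>f w\<bar>"
    proof (cases "f w = 0")
      case False
      then have "sq_norm n (s w) \<le> \<rho>" using \<rho>(2)[OF w] s w by (force simp: shrinking_def)
      then have "\<bar>re_kernel n z (s w)\<bar> \<le> 2 / (1 - \<rho>)"
        using z \<rho>(1) by (intro re_kernel_bound) (auto simp: unit_ball_iff)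
      then show ?thesis by (simp only: abs_mult mult_right_mono abs_ge_zero)
    qed simp
  qed (use \<rho> in simp)
qed

lemma integrable_kernel:
  assumes f: "inner_L1 f" and s: "shrinking s" and z: "z \<in> unit_ball n"
  shows "integrable M (\<lambda>w. re_kernel n z (s w) * f w)"
proof -
  obtain B where B: "\<And>s z w. shrinking s \<Longrightarrow> z \<in> unit_ball n \<Longrightarrow> w \<in> unit_ball n \<Longrightarrow>
    \<bar>re_kernel n z (s w) * f w\<bar> \<le> B * \<bar>f w\<bar>" "0 \<le> B"
    using inner_L1_kernel_bound[OF f] by metis
  have [measurable]: "s \<in> borel_measurable M" "f \<in> borel_measurable M"
    using s f by (auto simp: shrinking_def inner_L1_def)
  have "integrable M (\<lambda>w. B * f w)" using f by (simp add: inner_L1_def)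
  then show ?thesis
    by (rule Bochner_Integration.integrable_bound)
      (use B s z in \<open>auto simp: space_eq abs_mult\<close>)
qed

lemma potential_bounded:
  assumes f: "inner_L1 f"
  obtains B where "0 \<le> B" "\<And>s z. shrinking s \<Longrightarrow> z \<in> unit_ball n \<Longrightarrow> \<bar>potential s f z\<bar> \<le> B"
proof -
  obtain B where B: "\<And>s z w. shrinking s \<Longrightarrow> z \<in> unit_ball n \<Longrightarrow> w \<in> unit_ball n \<Longrightarrow>
    \<bar>re_kernel n z (s w) * f w\<bar> \<le> B * \<bar>f w\<bar>" "0 \<le> B"
    using inner_L1_kernel_bound[OF f] by metis
  have int: "integrable M (\<lambda>w. B * \<bar>f w\<bar>)" using f by (simp add: inner_L1_def)
  show thesis
  proof (rule that[of "\<integral>w. B * \<bar>f w\<bar> \<partial>M"])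
    show "0 \<le> (\<integral>w. B * \<bar>f w\<bar> \<partial>M)" using B(2) by simp
    fix s z assume "shrinking s" "z \<in> unit_ball n"
    then show "\<bar>potential s f z\<bar> \<le> (\<integral>w. B * \<bar>f w\<bar> \<partial>M)"
      unfolding potential_def using B(1)
      by (intro order_trans[OF integral_abs_bound] integral_mono int integrable_abs
          integrable_kernel f) (auto simp: space_eq)
  qed
qed

lemma borel_measurable_potential:
  assumes f: "inner_L1 f" and s: "shrinking s" and t: "shrinking t"
  shows "(\<lambda>z. potential s f (t z)) \<in> borel_measurable M"
proof -
  have [measurable]: "s \<in> borel_measurable M" "t \<in> borel_measurable M" "f \<in> borel_measurable M"
    using s t f by (auto simp: shrinking_def inner_L1_def)
  show ?thesis
    unfolding potential_def by (rule borel_measurable_lebesgue_integral) measurable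
qed

text \<open>
  The evaluation point moves with the grid because the energy of a discretised function evaluates
  its potential at rounded points.
\<close>

lemma tendsto_potential:
  assumes f: "inner_L1 f" and z: "\<And>N. z N \<in> unit_ball n" "z' \<in> unit_ball n"
    and lim: "\<And>i. (\<lambda>N. z N i) \<longlonglongrightarrow> z' i"
  shows "(\<lambda>N. potential (grid N) f (z N)) \<longlonglongrightarrow> potential (\<lambda>w. w) f z'"
proof -
  obtain B where B: "\<And>s z w. shrinking s \<Longrightarrow> z \<in> unit_ball n \<Longrightarrow> w \<in> unit_ball n \<Longrightarrow>
    \<bar>re_kernel n z (s w) * f w\<bar> \<le> B * \<bar>f w\<bar>" "0 \<le> B"
    using inner_L1_kernel_bound[OF f] by metis
  show ?thesis
    unfolding potential_def
  proof (rule integral_dominated_convergence)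
    show "integrable M (\<lambda>w. B * \<bar>f w\<bar>)" using f by (simp add: inner_L1_def)
    show "(\<lambda>w. re_kernel n z' w * f w) \<in> borel_measurable M"
      using integrable_kernel[OF f shrinking_id z(2)] by auto
    show "(\<lambda>w. re_kernel n (z N) (grid N w) * f w) \<in> borel_measurable M" for N
      using integrable_kernel[OF f shrinking_grid z(1)] by auto
    show "AE w in M. (\<lambda>N. re_kernel n (z N) (grid N w) * f w) \<longlonglongrightarrow> re_kernel n z' w * f w"
      using z(2) by (intro AE_I2 tendsto_mult tendsto_const tendsto_re_kernel lim tendsto_grid)
        (auto simp: space_eq unit_ball_iff)
    show "AE w in M. norm (re_kernel n (z N) (grid N w) * f w) \<le> B * \<bar>f w\<bar>" for N
      using B(1)[OF shrinking_grid z(1)] by (intro AE_I2) (simp add: space_eq)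
  qed
qed

lemma integrable_bounded_mult:
  assumes "integrable M f" "u \<in> borel_measurable M" "\<And>w. w \<in> unit_ball n \<Longrightarrow> \<bar>u w\<bar> \<le> B"
  shows "integrable M (\<lambda>w. u w * f w :: real)"
proof -
  have [measurable]: "f \<in> borel_measurable M" "u \<in> borel_measurable M" using assms by auto
  have "integrable M (\<lambda>w. B * f w)" using assms by simp
  then show ?thesis
  proof (rule Bochner_Integration.integrable_bound)
    show "AE w in M. norm (u w * f w) \<le> norm (B * f w)"
      using assms(3) by (intro AE_I2) (force simp: space_eq abs_mult intro!: mult_right_mono)
  qed measurable
qed

lemma integrable_potential_mult:
  assumes "inner_L1 f" "shrinking s" "shrinking t" "integrable M g"
  shows "integrable M (\<lambda>w. potential s f (t w) * g w)"
proof -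
  obtain B where "\<And>s z. shrinking s \<Longrightarrow> z \<in> unit_ball n \<Longrightarrow> \<bar>potential s f z\<bar> \<le> B"
    using potential_bounded[OF assms(1)] by metis
  with assms show ?thesis
    by (intro integrable_bounded_mult[of _ _ B] borel_measurable_potential) (auto simp: shrinking_def)
qed

text \<open>
  The left-hand integrals are the squared norms of the discretised functions; their limit stands
  for \<open>\<parallel>J\<^sup>* f\<parallel>\<^sup>2\<close>.
\<close>

lemma tendsto_energy:
  assumes f: "inner_L1 f"
  shows "(\<lambda>N. \<integral>w. potential (grid N) f (grid N w) * f w \<partial>M)
           \<longlonglongrightarrow> (\<integral>w. potential (\<lambda>w. w) f w * f w \<partial>M)"
proof -
  obtain B where B: "0 \<le> B" "\<And>s z. shrinking s \<Longrightarrow> z \<in> unit_ball n \<Longrightarrow> \<bar>potential s f z\<bar> \<le> B"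
    using potential_bounded[OF f] by metis
  have int: "integrable M f" using f by (simp add: inner_L1_def)
  show ?thesis
  proof (rule integral_dominated_convergence)
    show "integrable M (\<lambda>w. B * \<bar>f w\<bar>)" using int by simp
    show "(\<lambda>w. potential (\<lambda>w. w) f w * f w) \<in> borel_measurable M"
      using integrable_potential_mult[OF f shrinking_id shrinking_id int] by auto
    show "(\<lambda>w. potential (grid N) f (grid N w) * f w) \<in> borel_measurable M" for N
      using integrable_potential_mult[OF f shrinking_grid shrinking_grid int] by auto
    show "AE w in M. (\<lambda>N. potential (grid N) f (grid N w) * f w) \<longlonglongrightarrow> potential (\<lambda>w. w) f w * f w"
      by (intro AE_I2 tendsto_mult tendsto_const tendsto_potential f tendsto_grid)
        (auto simp: space_eq grid_in_unit_ball)
    show "AE w in M. norm (potential (grid N) f (grid N w) * f w) \<le> B * \<bar>f w\<bar>" for N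
      using B(2)[OF shrinking_grid grid_in_unit_ball]
      by (intro AE_I2) (auto simp: space_eq abs_mult intro!: mult_right_mono)
  qed
qed

section \<open>Discretised potentials as elements of the space\<close>

lemma integral_grid_eq_sum:
  assumes f: "integrable M f"
  shows "(\<integral>w. \<phi> (grid N w) * f w \<partial>M) = (\<Sum>p\<in>grid N ` unit_ball n.
           \<phi> p * (\<integral>w. indicator {w \<in> unit_ball n. grid N w = p} w * f w \<partial>M) :: real)"
proof -
  define P where "P = grid N ` unit_ball n"
  have fin: "finite P" unfolding P_def by (rule finite_range_grid)
  have sets: "{w \<in> unit_ball n. grid N w = p} \<in> sets M" for p
  proof -
    have "grid N -` {p} \<inter> space M \<in> sets M"
      by (intro measurable_sets[OF measurable_on_ball[OF borel_measurable_grid]] borel_closed closed_singleton)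
    also have "grid N -` {p} \<inter> space M = {w \<in> unit_ball n. grid N w = p}"
      by (auto simp: space_eq)
    finally show ?thesis .
  qed
  have int: "integrable M (\<lambda>w. indicator {w \<in> unit_ball n. grid N w = p} w * f w)" for p
    using integrable_mult_indicator[OF sets f] by simp
  have "(\<integral>w. \<phi> (grid N w) * f w \<partial>M) =
      (\<integral>w. (\<Sum>p\<in>P. \<phi> p * (indicator {w \<in> unit_ball n. grid N w = p} w * f w)) \<partial>M)"
  proof (rule Bochner_Integration.integral_cong[OF refl])
    fix w assume "w \<in> space M"
    then have w: "w \<in> unit_ball n" by (simp add: space_eq)
    have "(\<Sum>p\<in>P. \<phi> p * (indicator {w \<in> unit_ball n. grid N w = p} w * f w)) =
        (\<Sum>p\<in>P. if p = grid N w then \<phi> p * f w else 0)"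
      using w by (intro sum.cong) (auto simp: indicator_def)
    also have "\<dots> = \<phi> (grid N w) * f w"
      using fin w by (subst sum.delta) (auto simp: P_def)
    finally show "\<phi> (grid N w) * f w =
      (\<Sum>p\<in>P. \<phi> p * (indicator {w \<in> unit_ball n. grid N w = p} w * f w))" by simp
  qed
  also have "\<dots> = (\<Sum>p\<in>P. \<phi> p * (\<integral>w. indicator {w \<in> unit_ball n. grid N w = p} w * f w \<partial>M))"
    by (subst Bochner_Integration.integral_sum) (auto intro!: int simp: int)
  finally show ?thesis unfolding P_def .
qed

text \<open>
  \<open>F\<close> is the discretisation \<open>\<integral> k\<^bsub>s w\<^esub> f(w) d\<mu>(w)\<close> of \<open>J\<^sup>* f\<close>, with \<open>s\<close> the grid map.  Since \<open>s\<close> takes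
  finitely many values \<open>p\<close>, it is the sum of the \<open>k\<^sub>p\<close> weighted by the integrals of \<open>f\<close> over the
  cells \<open>s w = p\<close>.  Taking \<open>h = F\<close> expresses its norm by its potential.
\<close>

lemma test_function:
  assumes da: "drury_arveson n H ip" and f: "integrable M f"
  obtains F where "F \<in> H"
    "\<And>h. h \<in> H \<Longrightarrow> Re (ip h F) = (\<integral>w. Re (h (grid N w)) * f w \<partial>M)"
    "\<And>z. z \<in> unit_ball n \<Longrightarrow> Re (F z) = potential (grid N) f z"
proof -
  interpret hilbert_function_space "unit_ball n" H ip
    using da by (simp add: drury_arveson_def)
  define c where "c p = (\<integral>w. indicator {w \<in> unit_ball n. grid N w = p} w * f w \<partial>M)" for p
  have K: "has_reproducing_kernel (unit_ball n) H ip (\<lambda>z w. 1 / (1 - hdot n w z))"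
    using da by (simp add: drury_arveson_def)
  have P: "finite (grid N ` unit_ball n)" "grid N ` unit_ball n \<subseteq> unit_ball n"
    using finite_range_grid grid_in_unit_ball by auto
  obtain F where F: "F \<in> H"
    "\<And>h. h \<in> H \<Longrightarrow> ip h F = (\<Sum>p\<in>grid N ` unit_ball n. cnj (of_real (c p)) * h p)"
    "\<And>z. z \<in> unit_ball n \<Longrightarrow> F z = (\<Sum>p\<in>grid N ` unit_ball n. of_real (c p) * (1 / (1 - hdot n p z)))"
    using kernel_combination[OF K P, of "\<lambda>p. of_real (c p)"] by auto
  show thesis
  proof (rule that[OF F(1)])
    fix h assume h: "h \<in> H"
    have "Re (ip h F) = (\<Sum>p\<in>grid N ` unit_ball n. Re (h p) * c p)"
      unfolding F(2)[OF h] Re_sum by (simp add: mult.commute)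
    then show "Re (ip h F) = (\<integral>w. Re (h (grid N w)) * f w \<partial>M)"
      unfolding c_def integral_grid_eq_sum[OF f, where \<phi>="\<lambda>p. Re (h p)"] .
  next
    fix z assume z: "z \<in> unit_ball n"
    have R: "re_kernel n z p = Re (1 / (1 - hdot n p z))" for p
      using re_kernel_commute[of n z p] by (simp only: re_kernel_def)
    have "Re (F z) = (\<Sum>p\<in>grid N ` unit_ball n. re_kernel n z p * c p)"
      unfolding F(3)[OF z] Re_sum R
      by (simp only: times_complex.sel Re_complex_of_real Im_complex_of_real mult_zero_left
          diff_zero mult.commute)
    then show "Re (F z) = potential (grid N) f z"
      unfolding c_def potential_def integral_grid_eq_sum[OF f, where \<phi>="re_kernel n z"] .
  qed
qed

section \<open>Reduction to functions supported well inside the ball\<close>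

lemma exhaustion:
  obtains E :: "nat \<Rightarrow> (nat \<Rightarrow> complex) set" where
    "\<And>k. E k \<in> sets M" "\<And>k. emeasure M (E k) < \<infinity>" "incseq E" "(\<Union>k. E k) = unit_ball n"
    "\<And>k. \<exists>\<rho><1. \<forall>z\<in>E k. sq_norm n z \<le> \<rho>"
proof -
  obtain A where A: "range A \<subseteq> sets M" "(\<Union>i. A i) = space M" "\<And>i. emeasure M (A i) \<noteq> \<infinity>" "incseq A"
    using sigma_finite_incseq by blast
  define E where "E k = A k \<inter> {z \<in> space M. sq_norm n z \<le> 1 - 1 / real (Suc k)}" for k
  have [measurable]: "sq_norm n \<in> borel_measurable M" by (rule measurable_on_ball) measurable
  have [measurable]: "A k \<in> sets M" for k using A by auto
  show thesis
  proof (rule that[of E])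
    show "E k \<in> sets M" for k unfolding E_def by measurable
    show "emeasure M (E k) < \<infinity>" for k
    proof -
      have "emeasure M (E k) \<le> emeasure M (A k)" unfolding E_def by (intro emeasure_mono) auto
      also have "\<dots> < \<infinity>" using A(3)[of k] by (simp add: less_top)
      finally show ?thesis .
    qed
    show "incseq E"
    proof (rule incseq_SucI)
      fix k
      have "A k \<subseteq> A (Suc k)" using A(4) by (auto simp: incseq_Suc_iff)
      moreover have "1 - 1 / real (Suc k) \<le> 1 - 1 / real (Suc (Suc k))" by (simp add: field_simps)
      ultimately show "E k \<subseteq> E (Suc k)" unfolding E_def by fastforce
    qed
    show "(\<Union>k. E k) = unit_ball n"
    proof (rule antisym)
      show "unit_ball n \<subseteq> (\<Union>k. E k)"
      proof
        fix z assume z: "z \<in> unit_ball n"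
        then obtain i where i: "z \<in> A i" using A(2) by (auto simp: space_eq)
        obtain j where j: "1 / real (Suc j) < 1 - sq_norm n z"
          using z reals_Archimedean[of "1 - sq_norm n z"] by (auto simp: unit_ball_iff inverse_eq_divide)
        have "z \<in> A (max i j)" using A(4) i by (meson incseqD max.cobounded1 subsetD)
        moreover have "1 / real (Suc (max i j)) \<le> 1 / real (Suc j)" by (intro divide_left_mono) auto
        then have "sq_norm n z \<le> 1 - 1 / real (Suc (max i j))" using j by linarith
        ultimately have "z \<in> E (max i j)" using z by (simp add: E_def space_eq del: of_nat_Suc)
        then show "z \<in> (\<Union>k. E k)" by blast
      qed
    qed (auto simp: E_def space_eq)
    show "\<exists>\<rho><1. \<forall>z\<in>E k. sq_norm n z \<le> \<rho>" for k
      by (rule exI[of _ "1 - 1 / real (Suc k)"]) (auto simp: E_def)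
  qed
qed

text \<open>
  On a set of finite measure \<open>L\<^sup>2\<close> is contained in \<open>L\<^sup>1\<close>, by \<open>\<bar>f\<bar> \<le> 1 + f\<^sup>2\<close>.
\<close>

lemma inner_L1_restrict:
  assumes "E \<in> sets M" "emeasure M E < \<infinity>" "\<exists>\<rho><1. \<forall>z\<in>E. sq_norm n z \<le> \<rho>"
    and f: "f \<in> borel_measurable M" and f2: "integrable M (\<lambda>w. (f w)\<^sup>2)"
  shows "inner_L1 (\<lambda>w. indicator E w * f w)" "integrable M (\<lambda>w. (indicator E w * f w)\<^sup>2)"
    "(\<integral>w. (indicator E w * f w)\<^sup>2 \<partial>M) \<le> (\<integral>w. (f w)\<^sup>2 \<partial>M)"
proof -
  have [measurable]: "E \<in> sets M" "f \<in> borel_measurable M" by fact+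
  have E: "integrable M (indicator E :: _ \<Rightarrow> real)" using assms(1,2) by simp
  have "integrable M (\<lambda>w. indicator E w + (f w)\<^sup>2)" using E f2 by simp
  then have "integrable M (\<lambda>w. indicator E w * f w)"
  proof (rule Bochner_Integration.integrable_bound)
    show "AE w in M. norm (indicator E w * f w) \<le> norm (indicator E w + (f w)\<^sup>2)"
    proof (rule AE_I2)
      fix w
      have "\<bar>f w\<bar> \<le> 1 + (f w)\<^sup>2"
        using sum_squares_bound[of "\<bar>f w\<bar>" 1] by simp
      then show "norm (indicator E w * f w) \<le> norm (indicator E w + (f w)\<^sup>2)"
        by (simp add: indicator_def)
    qed
  qed measurable
  with assms(3) show "inner_L1 (\<lambda>w. indicator E w * f w)"
    by (auto simp: inner_L1_def indicator_def)
  show int: "integrable M (\<lambda>w. (indicator E w * f w)\<^sup>2)"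
    using f2 by (rule Bochner_Integration.integrable_bound) (auto simp: indicator_def)
  show "(\<integral>w. (indicator E w * f w)\<^sup>2 \<partial>M) \<le> (\<integral>w. (f w)\<^sup>2 \<partial>M)"
    by (rule integral_mono[OF int f2]) (auto simp: indicator_def)
qed

lemma potential_nonneg:
  assumes "z \<in> unit_ball n" "\<And>w. w \<in> unit_ball n \<Longrightarrow> 0 \<le> f w"
  shows "0 \<le> potential (\<lambda>w. w) f z"
  unfolding potential_def using assms
  by (intro Bochner_Integration.integral_nonneg_AE AE_I2 mult_nonneg_nonneg re_kernel_nonneg)
    (auto simp: space_eq unit_ball_iff)

lemma nn_integral_kernel_eq_potential:
  assumes f: "inner_L1 f" "\<And>w. w \<in> unit_ball n \<Longrightarrow> 0 \<le> f w" and z: "z \<in> unit_ball n"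
  shows "(\<integral>\<^sup>+ w. ennreal (re_kernel n z w * f w) \<partial>M) = ennreal (potential (\<lambda>w. w) f z)"
  unfolding potential_def using z f(2)
  by (intro nn_integral_eq_integral integrable_kernel[OF f(1) shrinking_id z] AE_I2
      mult_nonneg_nonneg re_kernel_nonneg) (auto simp: space_eq unit_ball_iff)

section \<open>The Carleson condition bounds the bilinear form\<close>

text \<open>
  The Carleson condition for the discretised functions becomes \<open>\<parallel>U f\<parallel>\<^sup>2 \<le> C \<integral> (U f) f d\<mu>\<close> in the
  limit.  The right-hand side is finite because \<open>U f\<close> is bounded and \<open>f\<close> integrable, so
  \<open>\<parallel>U f\<parallel>\<close> may be cancelled after Cauchy--Schwarz.
\<close>

lemma carleson_potential_bound:
  assumes da: "drury_arveson n H ip" and C: "carleson_bound H ip M C" "0 \<le> C"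
    and f: "inner_L1 f" "\<And>w. w \<in> unit_ball n \<Longrightarrow> 0 \<le> f w" and f2: "integrable M (\<lambda>w. (f w)\<^sup>2)"
  shows "(\<integral>\<^sup>+ z. ennreal ((potential (\<lambda>w. w) f z)\<^sup>2) \<partial>M) \<le> ennreal (C\<^sup>2 * (\<integral>w. (f w)\<^sup>2 \<partial>M))"
proof -
  define U where "U = potential (\<lambda>w. w) f"
  define e where "e N = (\<integral>w. potential (grid N) f (grid N w) * f w \<partial>M)" for N
  define e' where "e' = (\<integral>w. U w * f w \<partial>M)"
  have int: "integrable M f" using f(1) by (simp add: inner_L1_def)
  have [measurable]: "U \<in> borel_measurable M" "f \<in> borel_measurable M"
    using borel_measurable_potential[OF f(1) shrinking_id shrinking_id] int by (auto simp: U_def)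
  have U_nonneg: "0 \<le> U z" if "z \<in> unit_ball n" for z
    unfolding U_def by (rule potential_nonneg[OF that f(2)])
  \<comment> \<open>The Carleson condition for the test function, keeping only real parts on the left.\<close>
  have N: "(\<integral>\<^sup>+ z. ennreal ((potential (grid N) f z)\<^sup>2) \<partial>M) \<le> ennreal (C * e N)" for N
  proof -
    obtain F where F: "F \<in> H"
      "\<And>h. h \<in> H \<Longrightarrow> Re (ip h F) = (\<integral>w. Re (h (grid N w)) * f w \<partial>M)"
      "\<And>z. z \<in> unit_ball n \<Longrightarrow> Re (F z) = potential (grid N) f z"
      using test_function[OF da int, of N] by metis
    have "(\<integral>\<^sup>+ z. ennreal ((potential (grid N) f z)\<^sup>2) \<partial>M) \<le> (\<integral>\<^sup>+ z. ennreal ((cmod (F z))\<^sup>2) \<partial>M)"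
    proof (intro nn_integral_mono ennreal_leI)
      fix z assume "z \<in> space M"
      then have "potential (grid N) f z = Re (F z)" using F(3) by (simp add: space_eq)
      then show "(potential (grid N) f z)\<^sup>2 \<le> (cmod (F z))\<^sup>2"
        using abs_Re_le_cmod[of "F z"] by (simp add: abs_le_square_iff[symmetric])
    qed
    also have "\<dots> \<le> ennreal (C * Re (ip F F))" using C F(1) by (simp add: carleson_bound_def)
    also have "Re (ip F F) = e N"
      unfolding F(2)[OF F(1)] e_def
      by (rule Bochner_Integration.integral_cong[OF refl]) (simp add: F(3) space_eq grid_in_unit_ball)
    finally show ?thesis .
  qed
  have "(\<integral>\<^sup>+ z. ennreal ((U z)\<^sup>2) \<partial>M) =
      (\<integral>\<^sup>+ z. liminf (\<lambda>N. ennreal ((potential (grid N) f z)\<^sup>2)) \<partial>M)"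
  proof (rule nn_integral_cong)
    fix z assume "z \<in> space M"
    then have "(\<lambda>N. potential (grid N) f z) \<longlonglongrightarrow> U z"
      unfolding U_def by (intro tendsto_potential f) (auto simp: space_eq)
    then have "(\<lambda>N. ennreal ((potential (grid N) f z)\<^sup>2)) \<longlonglongrightarrow> ennreal ((U z)\<^sup>2)"
      by (intro tendsto_ennrealI tendsto_power)
    then show "ennreal ((U z)\<^sup>2) = liminf (\<lambda>N. ennreal ((potential (grid N) f z)\<^sup>2))"
      by (rule lim_imp_Liminf[OF sequentially_bot, symmetric])
  qed
  also have "\<dots> \<le> liminf (\<lambda>N. \<integral>\<^sup>+ z. ennreal ((potential (grid N) f z)\<^sup>2) \<partial>M)"
  proof (rule nn_integral_liminf)
    fix N
    have "potential (grid N) f \<in> borel_measurable M"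
      using borel_measurable_potential[OF f(1) shrinking_grid shrinking_id] .
    then show "(\<lambda>z. ennreal ((potential (grid N) f z)\<^sup>2)) \<in> borel_measurable M" by measurable
  qed
  also have "\<dots> \<le> liminf (\<lambda>N. ennreal (C * e N))"
    by (intro Liminf_mono always_eventually allI N)
  also have "\<dots> = ennreal (C * e')"
  proof -
    have "e \<longlonglongrightarrow> e'"
      using tendsto_energy[OF f(1)] by (simp add: e_def[abs_def] e'_def U_def)
    then have "(\<lambda>N. ennreal (C * e N)) \<longlonglongrightarrow> ennreal (C * e')"
      by (intro tendsto_ennrealI tendsto_mult tendsto_const)
    then show ?thesis by (rule lim_imp_Liminf[OF sequentially_bot])
  qed
  finally have A: "(\<integral>\<^sup>+ z. ennreal ((U z)\<^sup>2) \<partial>M) \<le> ennreal (C * e')" .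
  define b where "b = (\<integral>w. (f w)\<^sup>2 \<partial>M)"
  have b: "(\<integral>\<^sup>+ w. ennreal ((f w)\<^sup>2) \<partial>M) = ennreal b" "0 \<le> b"
    unfolding b_def by (auto intro!: nn_integral_eq_integral f2)
  have e'0: "0 \<le> e'"
    unfolding e'_def using U_nonneg f(2)
    by (intro Bochner_Integration.integral_nonneg_AE AE_I2) (simp add: space_eq)
  have "(\<integral>\<^sup>+ z. ennreal ((U z)\<^sup>2) \<partial>M) < \<infinity>" using A by (rule le_less_trans) simp
  then obtain a where a: "(\<integral>\<^sup>+ z. ennreal ((U z)\<^sup>2) \<partial>M) = ennreal a" "0 \<le> a"
    by (metis ennreal_cases infinity_ennreal_def less_irrefl)
  have e'_eq: "(\<integral>\<^sup>+ w. ennreal (U w) * ennreal (f w) \<partial>M) = ennreal e'"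
  proof -
    have "(\<integral>\<^sup>+ w. ennreal (U w) * ennreal (f w) \<partial>M) = (\<integral>\<^sup>+ w. ennreal (U w * f w) \<partial>M)"
      by (intro nn_integral_cong) (simp add: ennreal_mult' U_nonneg space_eq)
    also have "\<dots> = ennreal e'"
      unfolding e'_def using U_nonneg f(2) integrable_potential_mult[OF f(1) shrinking_id shrinking_id int]
      by (intro nn_integral_eq_integral AE_I2) (simp_all add: space_eq U_def)
    finally show ?thesis .
  qed
  have "(ennreal e')\<^sup>2 \<le> (\<integral>\<^sup>+ w. (ennreal (U w))\<^sup>2 \<partial>M) * (\<integral>\<^sup>+ w. (ennreal (f w))\<^sup>2 \<partial>M)"
    unfolding e'_eq[symmetric] by (rule Cauchy_Schwarz_nn_integral) measurable
  also have "(\<integral>\<^sup>+ w. (ennreal (U w))\<^sup>2 \<partial>M) = ennreal a"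
    unfolding a(1)[symmetric] by (intro nn_integral_cong) (simp add: ennreal_power U_nonneg space_eq)
  also have "(\<integral>\<^sup>+ w. (ennreal (f w))\<^sup>2 \<partial>M) = ennreal b"
    unfolding b(1)[symmetric] by (intro nn_integral_cong) (simp add: ennreal_power f(2) space_eq)
  finally have CS: "e'\<^sup>2 \<le> a * b"
    using a(2) b(2) e'0 by (simp add: ennreal_power ennreal_mult[symmetric])
  have ae: "a \<le> C * e'" using A a e'0 C(2) by simp
  have "a \<le> C\<^sup>2 * b"
  proof (cases "a = 0")
    case True then show ?thesis using b(2) by simp
  next
    case False
    have "a * a \<le> (C * e')\<^sup>2"
      using ae a(2) by (simp add: power2_eq_square mult_mono)
    also have "\<dots> \<le> C\<^sup>2 * (a * b)" using CS by (simp add: power_mult_distrib mult_left_mono)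
    finally have "a * a \<le> a * (C\<^sup>2 * b)" by (simp add: ac_simps)
    then show ?thesis using False a(2) by simp
  qed
  then show ?thesis unfolding a(1)[unfolded U_def] b_def by (rule ennreal_leI)
qed

text \<open>
  For a cut-off \<open>f\<close> this is Cauchy--Schwarz and the bound on the potential.  As all integrands are
  nonnegative, monotone convergence reaches general \<open>f\<close>, first in the inner and then in the outer
  integral.
\<close>

lemma carleson_imp_bilinear:
  assumes da: "drury_arveson n H ip" and C: "carleson_bound H ip M C" "0 \<le> C"
  shows "bilinear_bound n M C"
  unfolding bilinear_bound_def
proof (intro allI impI)
  fix f g assume f: "nonneg_L2 M f" and g: "nonneg_L2 M g"
  have [measurable]: "f \<in> borel_measurable M" "g \<in> borel_measurable M"
    using f g by (auto simp: nonneg_L2_def)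
  have f0: "0 \<le> f w" if "w \<in> unit_ball n" for w using f that by (simp add: nonneg_L2_def space_eq)
  have g0: "0 \<le> g w" if "w \<in> unit_ball n" for w using g that by (simp add: nonneg_L2_def space_eq)
  have f2: "integrable M (\<lambda>w. (f w)\<^sup>2)" and g2: "integrable M (\<lambda>w. (g w)\<^sup>2)"
    using f g by (auto simp: nonneg_L2_def)
  define c where "c = C * L2_norm M f * L2_norm M g"
  have c: "0 \<le> c" unfolding c_def L2_norm_def using C(2) by simp
  obtain E :: "nat \<Rightarrow> (nat \<Rightarrow> complex) set" where E:
    "\<And>k. E k \<in> sets M" "\<And>k. emeasure M (E k) < \<infinity>" "incseq E" "(\<Union>k. E k) = unit_ball n"
    "\<And>k. \<exists>\<rho><1. \<forall>z\<in>E k. sq_norm n z \<le> \<rho>"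
    using exhaustion by metis
  have [measurable]: "E k \<in> sets M" for k by (rule E)
  define fk where "fk k = (\<lambda>w. indicator (E k) w * f w)" for k
  define I where "I k z = (\<integral>\<^sup>+ w. ennreal (re_kernel n z w * fk k w) \<partial>M)" for k z
  have fk: "inner_L1 (fk k)" "integrable M (\<lambda>w. (fk k w)\<^sup>2)"
    "(\<integral>w. (fk k w)\<^sup>2 \<partial>M) \<le> (\<integral>w. (f w)\<^sup>2 \<partial>M)" for k
    unfolding fk_def using inner_L1_restrict[OF E(1,2,5) _ f2] by auto
  have fk0: "0 \<le> fk k w" if "w \<in> unit_ball n" for k w using f0[OF that] by (simp add: fk_def)
  have [measurable]: "fk k \<in> borel_measurable M" for k unfolding fk_def by measurable
  have id [measurable]: "(\<lambda>w. w) \<in> borel_measurable M" using shrinking_id by (simp add: shrinking_def)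
  have [measurable]: "I k \<in> borel_measurable M" for k
    unfolding I_def[abs_def] by (rule borel_measurable_nn_integral) measurable
  have bound: "(\<integral>\<^sup>+ z. I k z * ennreal (g z) \<partial>M) \<le> ennreal c" for k
  proof (rule ennreal_power2_le_imp_le[OF _ c])
    have "(\<integral>\<^sup>+ z. I k z * ennreal (g z) \<partial>M)\<^sup>2 \<le>
        (\<integral>\<^sup>+ z. (I k z)\<^sup>2 \<partial>M) * (\<integral>\<^sup>+ z. (ennreal (g z))\<^sup>2 \<partial>M)"
      by (rule Cauchy_Schwarz_nn_integral) measurable
    also have "(\<integral>\<^sup>+ z. (I k z)\<^sup>2 \<partial>M) = (\<integral>\<^sup>+ z. ennreal ((potential (\<lambda>w. w) (fk k) z)\<^sup>2) \<partial>M)"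
      unfolding I_def using fk(1) fk0
      by (intro nn_integral_cong)
        (simp add: nn_integral_kernel_eq_potential space_eq ennreal_power potential_nonneg)
    also have "\<dots> \<le> ennreal (C\<^sup>2 * (\<integral>w. (fk k w)\<^sup>2 \<partial>M))"
      by (rule carleson_potential_bound[OF da C fk(1) fk0 fk(2)])
    also have "\<dots> \<le> ennreal (C\<^sup>2 * (\<integral>w. (f w)\<^sup>2 \<partial>M))"
      by (intro ennreal_leI mult_left_mono fk) simp
    also have "(\<integral>\<^sup>+ z. (ennreal (g z))\<^sup>2 \<partial>M) = (\<integral>\<^sup>+ z. ennreal ((g z)\<^sup>2) \<partial>M)"
      by (intro nn_integral_cong) (simp add: ennreal_power g0 space_eq)
    also have "\<dots> = ennreal (\<integral>w. (g w)\<^sup>2 \<partial>M)"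
      by (intro nn_integral_eq_integral g2) simp
    also have "ennreal (C\<^sup>2 * (\<integral>w. (f w)\<^sup>2 \<partial>M)) * ennreal (\<integral>w. (g w)\<^sup>2 \<partial>M) = ennreal (c\<^sup>2)"
      by (simp add: c_def L2_norm_def power_mult_distrib flip: ennreal_mult)
    finally show "(\<integral>\<^sup>+ z. I k z * ennreal (g z) \<partial>M)\<^sup>2 \<le> ennreal (c\<^sup>2)"
      by (simp add: mult_right_mono)
  qed
  have mono_fk: "fk k w \<le> fk l w" if "k \<le> l" "w \<in> unit_ball n" for k l w
    using E(3) that f0 by (auto simp: fk_def indicator_def incseq_def)
  have I_SUP: "(\<integral>\<^sup>+ w. ennreal (re_kernel n z w * f w) \<partial>M) = (SUP k. I k z)" if z: "z \<in> unit_ball n" for z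
  proof -
    have "(\<integral>\<^sup>+ w. ennreal (re_kernel n z w * f w) \<partial>M) =
        (\<integral>\<^sup>+ w. (SUP k. ennreal (re_kernel n z w * fk k w)) \<partial>M)"
    proof (rule nn_integral_cong)
      fix w assume "w \<in> space M"
      then have w: "w \<in> unit_ball n" by (simp add: space_eq)
      then obtain k where k: "w \<in> E k" using E(4) by auto
      have R0: "0 \<le> re_kernel n z w" using z w by (auto simp: unit_ball_iff intro: re_kernel_nonneg)
      show "ennreal (re_kernel n z w * f w) = (SUP k. ennreal (re_kernel n z w * fk k w))"
      proof (rule antisym)
        show "ennreal (re_kernel n z w * f w) \<le> (SUP k. ennreal (re_kernel n z w * fk k w))"
          using k by (intro SUP_upper2[of k]) (auto simp: fk_def)
        show "(SUP k. ennreal (re_kernel n z w * fk k w)) \<le> ennreal (re_kernel n z w * f w)"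
          using R0 f0[OF w]
          by (intro SUP_least ennreal_leI mult_left_mono) (auto simp: fk_def indicator_def)
      qed
    qed
    also have "\<dots> = (SUP k. I k z)"
      unfolding I_def
    proof (rule nn_integral_monotone_convergence_SUP_AE)
      show "AE w in M. ennreal (re_kernel n z w * fk k w) \<le> ennreal (re_kernel n z w * fk (Suc k) w)" for k
        using z mono_fk[of k "Suc k"]
        by (intro AE_I2 ennreal_leI mult_left_mono) (auto simp: space_eq unit_ball_iff intro: re_kernel_nonneg)
    qed measurable
    finally show ?thesis .
  qed
  have "(\<integral>\<^sup>+ z. (\<integral>\<^sup>+ z'. ennreal (Re (1 / (1 - hdot n z z')) * f z') \<partial>M) * ennreal (g z) \<partial>M) =
      (\<integral>\<^sup>+ z. (SUP k. I k z * ennreal (g z)) \<partial>M)"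
    by (intro nn_integral_cong)
      (simp add: I_SUP[unfolded re_kernel_def] space_eq SUP_mult_right_ennreal)
  also have "\<dots> = (SUP k. \<integral>\<^sup>+ z. I k z * ennreal (g z) \<partial>M)"
  proof (rule nn_integral_monotone_convergence_SUP_AE)
    show "AE z in M. I k z * ennreal (g z) \<le> I (Suc k) z * ennreal (g z)" for k
      unfolding I_def using mono_fk[of k "Suc k"]
      by (intro AE_I2 mult_right_mono nn_integral_mono ennreal_leI mult_left_mono)
        (auto simp: space_eq unit_ball_iff intro: re_kernel_nonneg)
  qed measurable
  also have "\<dots> \<le> ennreal c" by (intro SUP_least bound)
  finally show "(\<integral>\<^sup>+ z. (\<integral>\<^sup>+ z'. ennreal (Re (1 / (1 - hdot n z z')) * f z') \<partial>M) * ennreal (g z) \<partial>M)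
      \<le> ennreal (C * L2_norm M f * L2_norm M g)" unfolding c_def .
qed

section \<open>The bilinear bound gives the Carleson condition\<close>

lemma potential_diff:
  assumes "inner_L1 a" "inner_L1 b" "z \<in> unit_ball n"
  shows "potential (\<lambda>w. w) (\<lambda>w. a w - b w) z = potential (\<lambda>w. w) a z - potential (\<lambda>w. w) b z"
  unfolding potential_def right_diff_distrib
  by (intro Bochner_Integration.integral_diff integrable_kernel[OF _ shrinking_id] assms)

lemma energy_le_nonneg:
  assumes B: "bilinear_bound n M C" "0 \<le> C"
    and f: "inner_L1 f" "\<And>w. w \<in> unit_ball n \<Longrightarrow> 0 \<le> f w" and f2: "integrable M (\<lambda>w. (f w)\<^sup>2)"
  shows "(\<integral>w. potential (\<lambda>w. w) f w * f w \<partial>M) \<le> C * (\<integral>w. (f w)\<^sup>2 \<partial>M)"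
proof -
  have int: "integrable M f" using f(1) by (simp add: inner_L1_def)
  have L2: "nonneg_L2 M f" using int f(2) f2 by (auto simp: nonneg_L2_def space_eq)
  have "ennreal (\<integral>w. potential (\<lambda>w. w) f w * f w \<partial>M) = (\<integral>\<^sup>+ w. ennreal (potential (\<lambda>w. w) f w * f w) \<partial>M)"
    using potential_nonneg[OF _ f(2)] f(2)
    by (intro nn_integral_eq_integral[symmetric] integrable_potential_mult[OF f(1) shrinking_id shrinking_id int] AE_I2)
      (simp add: space_eq)
  also have "\<dots> = (\<integral>\<^sup>+ z. (\<integral>\<^sup>+ z'. ennreal (Re (1 / (1 - hdot n z z')) * f z') \<partial>M) * ennreal (f z) \<partial>M)"
    using potential_nonneg[OF _ f(2)] f(2)
    by (intro nn_integral_cong)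
      (simp add: nn_integral_kernel_eq_potential[OF f, unfolded re_kernel_def] space_eq ennreal_mult)
  also have "\<dots> \<le> ennreal (C * L2_norm M f * L2_norm M f)"
    using B(1) L2 unfolding bilinear_bound_def by blast
  also have "C * L2_norm M f * L2_norm M f = C * (\<integral>w. (f w)\<^sup>2 \<partial>M)"
    by (simp add: L2_norm_def mult.assoc flip: power2_eq_square)
  finally show ?thesis using B(2) by (subst (asm) ennreal_le_iff) auto
qed

text \<open>
  The hypothesis speaks of nonnegative functions only.  It extends to real \<open>f\<close> because the kernel
  has nonnegative real part: the interaction of the positive with the negative part of \<open>f\<close> can only
  lower the energy.
\<close>

lemma energy_le:
  assumes B: "bilinear_bound n M C" "0 \<le> C"
    and f: "inner_L1 f" and f2: "integrable M (\<lambda>w. (f w)\<^sup>2)"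
  shows "(\<integral>w. potential (\<lambda>w. w) f w * f w \<partial>M) \<le> C * (\<integral>w. (f w)\<^sup>2 \<partial>M)"
proof -
  define a b where "a w = max 0 (f w)" and "b w = max 0 (- f w)" for w
  have int: "integrable M f" using f by (simp add: inner_L1_def)
  have ab: "inner_L1 a" "inner_L1 b"
    using f by (auto simp: inner_L1_def a_def[abs_def] b_def[abs_def])
  then have iab: "integrable M a" "integrable M b" by (simp_all add: inner_L1_def)
  have ab0: "0 \<le> a w" "0 \<le> b w" for w by (simp_all add: a_def b_def)
  have [measurable]: "f \<in> borel_measurable M" "a \<in> borel_measurable M" "b \<in> borel_measurable M"
    using int iab by auto
  have a2: "integrable M (\<lambda>w. (a w)\<^sup>2)" and b2: "integrable M (\<lambda>w. (b w)\<^sup>2)"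
    by (rule Bochner_Integration.integrable_bound[OF f2]; auto simp: a_def b_def max_def)+
  let ?U = "potential (\<lambda>w. w)"
  have f_eq: "f = (\<lambda>w. a w - b w)" by (auto simp: a_def b_def max_def)
  have i: "integrable M (\<lambda>w. ?U a w * a w)" "integrable M (\<lambda>w. ?U b w * b w)" "integrable M (\<lambda>w. ?U f w * f w)"
    by (intro integrable_potential_mult shrinking_id ab iab int f)+
  have "(\<integral>w. ?U f w * f w \<partial>M) \<le> (\<integral>w. ?U a w * a w + ?U b w * b w \<partial>M)"
  proof (intro integral_mono i Bochner_Integration.integrable_add)
    fix w assume "w \<in> space M"
    then have w: "w \<in> unit_ball n" by (simp add: space_eq)
    have U: "?U f w = ?U a w - ?U b w" unfolding f_eq by (rule potential_diff[OF ab w])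
    have fw: "f w = a w - b w" by (simp add: a_def b_def max_def)
    have "?U f w * f w = ?U a w * a w + ?U b w * b w - (?U a w * b w + ?U b w * a w)"
      unfolding U unfolding fw by (simp add: algebra_simps)
    moreover have "0 \<le> ?U a w * b w + ?U b w * a w"
      using potential_nonneg[OF w, of a] potential_nonneg[OF w, of b] ab0 by simp
    ultimately show "?U f w * f w \<le> ?U a w * a w + ?U b w * b w" by linarith
  qed
  also have "\<dots> = (\<integral>w. ?U a w * a w \<partial>M) + (\<integral>w. ?U b w * b w \<partial>M)" using i by simp
  also have "\<dots> \<le> C * (\<integral>w. (a w)\<^sup>2 \<partial>M) + C * (\<integral>w. (b w)\<^sup>2 \<partial>M)"
    by (intro add_mono energy_le_nonneg B ab ab0 a2 b2)
  also have "\<dots> = C * (\<integral>w. (a w)\<^sup>2 + (b w)\<^sup>2 \<partial>M)" using a2 b2 by (simp add: distrib_left)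
  also have "(\<lambda>w. (a w)\<^sup>2 + (b w)\<^sup>2) = (\<lambda>w. (f w)\<^sup>2)" by (auto simp: a_def b_def max_def)
  finally show ?thesis .
qed

text \<open>
  With \<open>f = Re h\<close> on \<open>E\<close>, Cauchy--Schwarz in the space gives
  \<open>(\<integral> f\<^sup>2 d\<mu>)\<^sup>2 = (Re \<langle>h, J\<^sup>* f\<rangle>)\<^sup>2 \<le> \<parallel>h\<parallel>\<^sup>2 \<parallel>J\<^sup>* f\<parallel>\<^sup>2 \<le> \<parallel>h\<parallel>\<^sup>2 C \<integral> f\<^sup>2 d\<mu>\<close>, and one factor \<open>\<integral> f\<^sup>2 d\<mu>\<close>
  cancels.  The argument runs on the discretisations of \<open>J\<^sup>* f\<close>.
\<close>

lemma real_part_bound: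
  assumes da: "drury_arveson n H ip" and B: "bilinear_bound n M C" "0 \<le> C" and h: "h \<in> H"
    and E: "E \<in> sets M" "emeasure M E < \<infinity>" "\<exists>\<rho><1. \<forall>z\<in>E. sq_norm n z \<le> \<rho>"
  shows "(\<integral>\<^sup>+ z. ennreal ((Re (h z))\<^sup>2) * indicator E z \<partial>M) \<le> ennreal (C * Re (ip h h))"
proof -
  interpret hilbert_function_space "unit_ball n" H ip
    using da by (simp add: drury_arveson_def)
  obtain \<rho> where \<rho>: "\<rho> < 1" "\<And>z. z \<in> E \<Longrightarrow> sq_norm n z \<le> \<rho>" using E(3) by auto
  \<comment> \<open>Elements of the space are bounded where \<open>K(w,w)\<close> is; dominated convergence needs such a bound.\<close>
  define D where "D = sqrt (Re (ip h h) * (2 / (1 - \<rho>)))"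
  have D: "\<bar>Re (h w)\<bar> \<le> D" if w: "w \<in> unit_ball n" "sq_norm n w \<le> \<rho>" for w
  proof -
    define k where "k = (\<lambda>z. if z \<in> unit_ball n then 1 / (1 - hdot n w z) else 0)"
    have k: "k \<in> H" "\<And>h. h \<in> H \<Longrightarrow> h w = ip h k"
      using da w unfolding drury_arveson_def has_reproducing_kernel_def k_def by auto
    have "Re (ip k k) = re_kernel n w w"
      using k(2)[OF k(1)] w by (simp add: k_def re_kernel_def)
    also have "\<dots> \<le> 2 / (1 - \<rho>)"
      using re_kernel_bound[of n w w \<rho>] w \<rho>(1) by (simp add: unit_ball_iff)
    finally have "(Re (h w))\<^sup>2 \<le> Re (ip h h) * (2 / (1 - \<rho>))"
      unfolding k(2)[OF h]
      by (intro order_trans[OF Re_ip_Cauchy_Schwarz[OF h k(1)]] mult_left_mono ip_nonneg h)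
    then show ?thesis unfolding D_def using real_sqrt_le_mono by fastforce
  qed
  have cont: "continuous_on (unit_ball n) h"
    using da h by (auto simp: drury_arveson_def holomorphic_on_unit_ball_def)
  then have [measurable]: "h \<in> borel_measurable M"
    by (simp add: measurable_cong_sets[OF sets_eq refl] borel_measurable_continuous_on_restrict)
  have [measurable]: "E \<in> sets M" by (rule E)
  have EX: "E \<subseteq> unit_ball n" using sets.sets_into_space[OF E(1)] by (simp add: space_eq)
  define f where "f w = indicator E w * Re (h w)" for w
  have [measurable]: "f \<in> borel_measurable M" unfolding f_def[abs_def] by measurable
  have fD: "\<bar>f w\<bar> \<le> D * indicator E w" for w
    using D[of w] \<rho>(2)[of w] EX by (auto simp: f_def indicator_def)
  have iE: "integrable M (indicator E :: _ \<Rightarrow> real)" using E by simp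
  have intf: "integrable M f"
  proof (rule Bochner_Integration.integrable_bound)
    show "integrable M (\<lambda>w. D * indicator E w)" using iE by simp
    show "AE w in M. norm (f w) \<le> norm (D * indicator E w)"
      by (intro AE_I2) (metis fD abs_ge_self order_trans real_norm_def)
  qed measurable
  have f: "inner_L1 f"
    unfolding inner_L1_def using intf \<rho> by (auto simp: f_def indicator_def)
  have f2: "integrable M (\<lambda>w. (f w)\<^sup>2)"
  proof (rule Bochner_Integration.integrable_bound)
    show "integrable M (\<lambda>w. D\<^sup>2 * indicator E w)" using iE by simp
    show "AE w in M. norm ((f w)\<^sup>2) \<le> norm (D\<^sup>2 * indicator E w)"
    proof (rule AE_I2)
      fix w
      have "(f w)\<^sup>2 \<le> (D * indicator E w)\<^sup>2" using fD[of w] by (rule abs_le_square_iff[THEN iffD1, OF order_trans]) simp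
      also have "\<dots> = D\<^sup>2 * indicator E w" by (simp add: indicator_def)
      finally show "norm ((f w)\<^sup>2) \<le> norm (D\<^sup>2 * indicator E w)" by simp
    qed
  qed measurable
  define b where "b = (\<integral>w. (f w)\<^sup>2 \<partial>M)"
  define e where "e N = (\<integral>w. potential (grid N) f (grid N w) * f w \<partial>M)" for N
  define e' where "e' = (\<integral>w. potential (\<lambda>w. w) f w * f w \<partial>M)"
  define p where "p N = (\<integral>w. Re (h (grid N w)) * f w \<partial>M)" for N
  have CS: "(p N)\<^sup>2 \<le> Re (ip h h) * e N" for N
  proof -
    obtain F where F: "F \<in> H"
      "\<And>h. h \<in> H \<Longrightarrow> Re (ip h F) = (\<integral>w. Re (h (grid N w)) * f w \<partial>M)"
      "\<And>z. z \<in> unit_ball n \<Longrightarrow> Re (F z) = potential (grid N) f z"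
      using test_function[OF da intf, of N] by metis
    have "Re (ip F F) = e N"
      unfolding F(2)[OF F(1)] e_def
      by (rule Bochner_Integration.integral_cong[OF refl]) (simp add: F(3) space_eq grid_in_unit_ball)
    then show ?thesis
      using Re_ip_Cauchy_Schwarz[OF h F(1)] F(2)[OF h] by (simp add: p_def)
  qed
  have "e \<longlonglongrightarrow> e'"
    using tendsto_energy[OF f] by (simp add: e_def[abs_def] e'_def)
  moreover have "p \<longlonglongrightarrow> b"
    unfolding p_def b_def
  proof (rule integral_dominated_convergence)
    show "integrable M (\<lambda>w. D * \<bar>f w\<bar>)" using intf by simp
    show "(\<lambda>w. Re (h (grid N w)) * f w) \<in> borel_measurable M" for N
    proof -
      have "grid N \<in> measurable M M"
        using measurable_on_ball[OF borel_measurable_grid, of N] grid_in_unit_ball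
        by (subst measurable_cong_sets[OF refl sets_eq], intro measurable_restrict_space2)
          (auto simp: space_eq)
      then have "(\<lambda>w. h (grid N w)) \<in> borel_measurable M" by measurable
      then show ?thesis by measurable
    qed
    show "AE w in M. (\<lambda>N. Re (h (grid N w)) * f w) \<longlonglongrightarrow> (f w)\<^sup>2"
    proof (rule AE_I2)
      fix w assume "w \<in> space M"
      then have w: "w \<in> unit_ball n" by (simp add: space_eq)
      have "(\<lambda>N. grid N w) \<longlonglongrightarrow> w"
        using tendsto_grid[of w] limitin_componentwise[of "\<lambda>_. euclidean" UNIV "\<lambda>N. grid N w" w sequentially]
        by (simp add: euclidean_product_topology)
      then have "(\<lambda>N. h (grid N w)) \<longlonglongrightarrow> h w"
        using w by (intro continuous_on_tendsto_compose[OF cont]) (auto intro: grid_in_unit_ball always_eventually)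
      then have "(\<lambda>N. Re (h (grid N w)) * f w) \<longlonglongrightarrow> Re (h w) * f w"
        by (intro tendsto_intros)
      also have "Re (h w) * f w = (f w)\<^sup>2" by (auto simp: f_def indicator_def power2_eq_square)
      finally show "(\<lambda>N. Re (h (grid N w)) * f w) \<longlonglongrightarrow> (f w)\<^sup>2" .
    qed
    show "AE w in M. norm (Re (h (grid N w)) * f w) \<le> D * \<bar>f w\<bar>" for N
    proof (rule AE_I2)
      fix w assume "w \<in> space M"
      then have w: "w \<in> unit_ball n" by (simp add: space_eq)
      show "norm (Re (h (grid N w)) * f w) \<le> D * \<bar>f w\<bar>"
      proof (cases "w \<in> E")
        case True
        then have "\<bar>Re (h (grid N w))\<bar> \<le> D"
          using D[OF grid_in_unit_ball[OF w, of N]] \<rho>(2)[OF True] sq_norm_grid_le[of n N w] by linarith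
        then show ?thesis by (simp add: abs_mult mult_right_mono)
      qed (simp add: f_def)
    qed
  qed measurable
  ultimately have "b\<^sup>2 \<le> Re (ip h h) * e'"
    by (intro LIMSEQ_le[OF tendsto_power tendsto_mult_left]) (use CS in auto)
  also have "\<dots> \<le> Re (ip h h) * (C * b)"
    unfolding e'_def b_def by (intro mult_left_mono energy_le B f f2 ip_nonneg h)
  finally have b2: "b * b \<le> b * (C * Re (ip h h))" by (simp add: power2_eq_square ac_simps)
  have b0: "0 \<le> b" unfolding b_def by simp
  have b: "b \<le> C * Re (ip h h)"
  proof (cases "b = 0")
    case True then show ?thesis using B(2) ip_nonneg[OF h] by simp
  next
    case False then show ?thesis using b2 b0 by simp
  qed
  have "(\<integral>\<^sup>+ z. ennreal ((Re (h z))\<^sup>2) * indicator E z \<partial>M) = (\<integral>\<^sup>+ z. ennreal ((f z)\<^sup>2) \<partial>M)"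
    by (intro nn_integral_cong) (simp add: f_def indicator_def)
  also have "\<dots> = ennreal b" unfolding b_def by (intro nn_integral_eq_integral f2) simp
  also have "\<dots> \<le> ennreal (C * Re (ip h h))" by (rule ennreal_leI[OF b])
  finally show ?thesis .
qed

text \<open>
  The factor 2 comes from treating the real and the imaginary part of \<open>h\<close> separately.
\<close>

lemma bilinear_imp_carleson:
  assumes da: "drury_arveson n H ip" and B: "bilinear_bound n M C" "0 \<le> C"
  shows "carleson_bound H ip M (2 * C)"
  unfolding carleson_bound_def
proof
  fix h assume h: "h \<in> H"
  interpret hilbert_function_space "unit_ball n" H ip
    using da by (simp add: drury_arveson_def)
  obtain E :: "nat \<Rightarrow> (nat \<Rightarrow> complex) set" where E:
    "\<And>k. E k \<in> sets M" "\<And>k. emeasure M (E k) < \<infinity>" "incseq E" "(\<Union>k. E k) = unit_ball n"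
    "\<And>k. \<exists>\<rho><1. \<forall>z\<in>E k. sq_norm n z \<le> \<rho>"
    using exhaustion by metis
  have [measurable]: "E k \<in> sets M" for k by (rule E)
  have "continuous_on (unit_ball n) h"
    using da h by (auto simp: drury_arveson_def holomorphic_on_unit_ball_def)
  then have [measurable]: "h \<in> borel_measurable M"
    by (simp add: measurable_cong_sets[OF sets_eq refl] borel_measurable_continuous_on_restrict)
  \<comment> \<open>The real part of \<open>h'\<close> is the imaginary part of \<open>h\<close>.\<close>
  define h' where "h' = (\<lambda>z. - \<i> * h z)"
  have h': "h' \<in> H" unfolding h'_def by (rule scale_mem[OF h])
  have ip': "ip h' h' = ip h h"
    unfolding h'_def ip_scale[OF h scale_mem[OF h]] ip_scale_right[OF h h] by simp
  have k: "(\<integral>\<^sup>+ z. ennreal ((cmod (h z))\<^sup>2) * indicator (E k) z \<partial>M) \<le> ennreal (2 * C * Re (ip h h))" for k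
  proof -
    have "(\<integral>\<^sup>+ z. ennreal ((cmod (h z))\<^sup>2) * indicator (E k) z \<partial>M) =
        (\<integral>\<^sup>+ z. ennreal ((Re (h z))\<^sup>2) * indicator (E k) z + ennreal ((Re (h' z))\<^sup>2) * indicator (E k) z \<partial>M)"
      by (intro nn_integral_cong) (simp add: h'_def cmod_power2 indicator_def flip: ennreal_plus)
    also have "\<dots> = (\<integral>\<^sup>+ z. ennreal ((Re (h z))\<^sup>2) * indicator (E k) z \<partial>M) +
        (\<integral>\<^sup>+ z. ennreal ((Re (h' z))\<^sup>2) * indicator (E k) z \<partial>M)"
      by (rule nn_integral_add) (auto simp: h'_def)
    also have "\<dots> \<le> ennreal (C * Re (ip h h)) + ennreal (C * Re (ip h' h'))"
      by (intro add_mono real_part_bound[OF da B _ E(1,2,5)] h h')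
    also have "\<dots> = ennreal (2 * C * Re (ip h h))"
      using B(2) ip_nonneg[OF h] by (simp add: ip' mult.assoc flip: ennreal_plus)
    finally show ?thesis .
  qed
  have "(\<integral>\<^sup>+ z. ennreal ((cmod (h z))\<^sup>2) \<partial>M) =
      (\<integral>\<^sup>+ z. (SUP k. ennreal ((cmod (h z))\<^sup>2) * indicator (E k) z) \<partial>M)"
  proof (rule nn_integral_cong)
    fix z assume "z \<in> space M"
    then obtain k where k: "z \<in> E k" using E(4) by (auto simp: space_eq)
    show "ennreal ((cmod (h z))\<^sup>2) = (SUP k. ennreal ((cmod (h z))\<^sup>2) * indicator (E k) z)"
      by (rule antisym, rule SUP_upper2[of k]) (auto intro!: SUP_least simp: k indicator_def)
  qed
  also have "\<dots> = (SUP k. \<integral>\<^sup>+ z. ennreal ((cmod (h z))\<^sup>2) * indicator (E k) z \<partial>M)"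
  proof (rule nn_integral_monotone_convergence_SUP_AE)
    show "AE z in M. ennreal ((cmod (h z))\<^sup>2) * indicator (E k) z \<le> ennreal ((cmod (h z))\<^sup>2) * indicator (E (Suc k)) z" for k
      using incseq_SucD[OF E(3), of k] by (intro AE_I2 mult_left_mono) (auto simp: indicator_def)
  qed measurable
  also have "\<dots> \<le> ennreal (2 * C * Re (ip h h))" by (intro SUP_least k)
  finally show "(\<integral>\<^sup>+ z. ennreal ((cmod (h z))\<^sup>2) \<partial>M) \<le> ennreal (2 * C * Re (ip h h))" .
qed

end

section \<open>The equivalence\<close>

lemma bilinear_bound_mono:
  assumes "bilinear_bound n \<mu> C" "C \<le> C'"
  shows "bilinear_bound n \<mu> C'"
  unfolding bilinear_bound_def
proof (intro allI impI)
  fix f g assume "nonneg_L2 \<mu> f" "nonneg_L2 \<mu> g"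
  then have "(\<integral>\<^sup>+ z. (\<integral>\<^sup>+ z'. ennreal (Re (1 / (1 - hdot n z z')) * f z') \<partial>\<mu>) * ennreal (g z) \<partial>\<mu>)
      \<le> ennreal (C * L2_norm \<mu> f * L2_norm \<mu> g)"
    using assms(1) by (simp add: bilinear_bound_def)
  also have "\<dots> \<le> ennreal (C' * L2_norm \<mu> f * L2_norm \<mu> g)"
    using assms(2) by (intro ennreal_leI mult_right_mono) (auto simp: L2_norm_def)
  finally show "(\<integral>\<^sup>+ z. (\<integral>\<^sup>+ z'. ennreal (Re (1 / (1 - hdot n z z')) * f z') \<partial>\<mu>) * ennreal (g z) \<partial>\<mu>)
      \<le> ennreal (C' * L2_norm \<mu> f * L2_norm \<mu> g)" .
qed

theorem proposition27:
  "(\<forall>n\<ge>1. \<forall>H ip \<mu>. drury_arveson n H ip \<longrightarrow> measure_on_unit_ball n \<mu> \<longrightarrow>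
      (carleson H ip \<mu> \<longleftrightarrow> (\<exists>C\<ge>0. bilinear_bound n \<mu> C))) \<and>
   (\<exists>K>0. \<forall>n\<ge>1. \<forall>H ip \<mu>. drury_arveson n H ip \<longrightarrow> measure_on_unit_ball n \<mu> \<longrightarrow>
      (\<forall>C\<ge>0. (carleson_bound H ip \<mu> C \<longrightarrow> bilinear_bound n \<mu> (K * C)) \<and>
              (bilinear_bound n \<mu> C \<longrightarrow> carleson_bound H ip \<mu> (K * C))))"
proof -
  have ball: "ball_measure \<mu> n" if "measure_on_unit_ball n \<mu>" for n \<mu>
    using that by (simp add: measure_on_unit_ball_def ball_measure_def ball_measure_axioms_def)
  have to_bilinear: "bilinear_bound n \<mu> C"
    if "drury_arveson n H ip" "measure_on_unit_ball n \<mu>" "carleson_bound H ip \<mu> C" "0 \<le> C" for n H ip \<mu> C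
    using ball_measure.carleson_imp_bilinear[OF ball] that by blast
  have to_carleson: "carleson_bound H ip \<mu> (2 * C)"
    if "drury_arveson n H ip" "measure_on_unit_ball n \<mu>" "bilinear_bound n \<mu> C" "0 \<le> C" for n H ip \<mu> C
    using ball_measure.bilinear_imp_carleson[OF ball] that by blast
  show ?thesis
  proof (intro conjI exI[of _ "2::real"] allI impI)
    fix n H ip \<mu> assume "drury_arveson n H ip" "measure_on_unit_ball n \<mu>"
    then show "carleson H ip \<mu> \<longleftrightarrow> (\<exists>C\<ge>0. bilinear_bound n \<mu> C)"
      unfolding carleson_def using to_bilinear to_carleson
      by (metis mult_nonneg_nonneg zero_le_numeral)
  next
    fix n H ip \<mu> and C :: real
    assume *: "drury_arveson n H ip" "measure_on_unit_ball n \<mu>" "0 \<le> C"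
    show "bilinear_bound n \<mu> (2 * C)" if "carleson_bound H ip \<mu> C"
      by (rule bilinear_bound_mono[OF to_bilinear[OF *(1,2) that *(3)]]) (use *(3) in simp)
    show "carleson_bound H ip \<mu> (2 * C)" if "bilinear_bound n \<mu> C"
      by (rule to_carleson[OF *(1,2) that *(3)])
  qed simp
qed

end
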